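(* Let $I$ be a nontrivial real interval, possibly unbounded, containing $0$. If $f\colon I\to\mathbb{R}$ satisfies $$f(x+x')=f(x)+f(x')\qquad\text{for all } x,x'\in I \text{ such that } x+x'\in I,$$ then either $f$ is of the form $f(x)=cx$ for some $c\in\mathbb{R}$, or the graph of $f$ is everywhere dense in $I\times\mathbb{R}$. The latter case is excluded as soon as $f$ is continuous at a point, or monotonic, or Lebesgue measurable, or bounded from one side on a set of positive measure.
   Context: An interval is nontrivial if it has positive Lebesgue measure. "Bounded from one side" means bounded from above or bounded from below. *)

theory Defs
  imports "HOL-Analysis.Analysis"
begin

definition nontrivial_interval :: "real set \<Rightarrow> bool" where
  "nontrivial_interval I \<longleftrightarrow> is_interval I \<and> emeasure lebesgue I > 0"

definition graph_on :: "real set \<Rightarrow> (real \<Rightarrow> real) \<Rightarrow> (real \<times> real) set" where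
  "graph_on I f = (\<lambda>x. (x, f x)) ` I"

(* For S contained in X, this is density in the subspace topology of X. *)
definition everywhere_dense_in :: "'a::topological_space set \<Rightarrow> 'a set \<Rightarrow> bool" where
  "everywhere_dense_in S X \<longleftrightarrow> S \<subseteq> X \<and> X \<subseteq> closure S"

definition bounded_from_one_side_on :: "real set \<Rightarrow> (real \<Rightarrow> real) \<Rightarrow> bool" where
  "bounded_from_one_side_on A f \<longleftrightarrow> bdd_above (f ` A) \<or> bdd_below (f ` A)"

end

theory Submission
  imports Defs
begin

text \<open>
  A solution on \<open>I\<close> is the restriction of an additive function \<open>F\<close> on the whole line: fix \<open>a \<noteq> 0\<close>
  in \<open>I\<close>, use the values of \<open>f\<close> between \<open>0\<close> and \<open>a\<close>, and continue by \<open>F (x + a) = F x + f a\<close>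
  (\<open>additive_extension\<close>). The assertion then concerns additive functions on the line, which are
  \<open>\<rat>\<close>-linear.

  If \<open>F\<close> is not of the form \<open>x \<mapsto> c x\<close>, two points of its graph are linearly independent vectors of
  the plane. The graph contains their rational combinations, and these approximate all of their
  real combinations, hence all points of the plane (\<open>additive_linear_or_dense\<close>). Restricting to
  the open strip over the interior of \<open>I\<close> gives the density of the graph of \<open>f\<close>
  (\<open>dense_graph_on_interval\<close>).

  For the second assertion, continuity at a point, monotonicity and measurability each give a
  subset of \<open>I\<close> of positive measure on which \<open>f\<close> is bounded from one side, so this last
  hypothesis is the only one to treat. If \<open>F \<le> M\<close> on such a set \<open>A\<close>, then \<open>F \<le> 2 M\<close> on the
  sumset \<open>A + A\<close>. By a theorem of Steinhaus, \<open>A + A\<close> contains an open interval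
  (\<open>Steinhaus_sumset\<close>), over which the graph of \<open>F\<close> is therefore not dense; hence \<open>F\<close> is linear
  (\<open>additive_bounded_above_imp_linear\<close>). The graph of a linear function lies on a line, which
  is a closed set that does not cover \<open>I \<times> \<real>\<close>.
\<close>

section \<open>Extending an additive function from an interval to the line\<close>

lemma interval_scale_mem:
  fixes I :: "real set"
  assumes "is_interval I" "0 \<in> I" "y \<in> I" "0 \<le> t" "t \<le> 1"
  shows "t * y \<in> I"
proof -
  have "convex I"
    using assms(1) is_interval_convex by blast
  then have "(1 - t) *\<^sub>R 0 + t *\<^sub>R y \<in> I"
    using assms by (intro convexD) auto
  then show ?thesis by simp
qed

lemma additive_of_nat_mult:
  fixes F :: "real \<Rightarrow> real"
  assumes "Modules.additive F"
  shows "F (of_nat n * x) = of_nat n * F x"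
proof (induction n)
  case 0
  then show ?case using Modules.additive.zero[OF assms] by simp
next
  case (Suc n)
  then show ?case using Modules.additive.add[OF assms] by (simp add: algebra_simps)
qed

text \<open>
  The extension is \<open>F x = n f(a) + f(r)\<close> for \<open>x = n a + r\<close> with \<open>r\<close> between \<open>0\<close> and \<open>a\<close>. When two
  remainders add up beyond \<open>a\<close>, additivity of \<open>F\<close> comes from splitting \<open>f(a)\<close> and \<open>f(s)\<close> at
  \<open>a - r\<close>. The functions \<open>F\<close> and \<open>f\<close> agree near \<open>0\<close> on \<open>I\<close> by construction, and then at every \<open>x\<close>
  in \<open>I\<close>, because both are multiplied by \<open>n\<close> when passing from \<open>x / n\<close> to \<open>x\<close>.
\<close>

lemma additive_extension:
  fixes I :: "real set" and f :: "real \<Rightarrow> real"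
  assumes I: "is_interval I" "0 \<in> I" and a: "a \<in> I" "a \<noteq> 0"
    and add: "\<And>x x'. x \<in> I \<Longrightarrow> x' \<in> I \<Longrightarrow> x + x' \<in> I \<Longrightarrow> f (x + x') = f x + f x'"
  obtains F where "Modules.additive F" "\<And>x. x \<in> I \<Longrightarrow> F x = f x"
proof
  define g where "g t = f (t * a)" for t
  define F where "F x = of_int \<lfloor>x / a\<rfloor> * g 1 + g (frac (x / a))" for x
  have f0: "f 0 = 0"
    using add[of 0 0] I(2) by simp
  have gadd: "g (s + t) = g s + g t" if "0 \<le> s" "0 \<le> t" "s + t \<le> 1" for s t
  proof -
    have "s * a \<in> I" "t * a \<in> I" "(s + t) * a \<in> I"
      using that by (intro interval_scale_mem I a; simp)+
    then show ?thesis
      unfolding g_def by (metis add distrib_right)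
  qed
  have gcarry: "g 1 + g (s + t - 1) = g s + g t"
    if "0 \<le> s" "0 \<le> t" "s \<le> 1" "t \<le> 1" "1 \<le> s + t" for s t
    using gadd[of s "1 - s"] gadd[of "1 - s" "s + t - 1"] that by simp
  show F: "Modules.additive F"
  proof
    fix x y
    show "F (x + y) = F x + F y"
    proof (cases "frac (x / a) + frac (y / a) < 1")
      case True
      then show ?thesis
        using gadd[of "frac (x / a)" "frac (y / a)"]
        by (simp add: F_def add_divide_distrib floor_add frac_add algebra_simps)
    next
      case False
      then show ?thesis
        using gcarry[of "frac (x / a)" "frac (y / a)"] frac_lt_1[of "x / a"] frac_lt_1[of "y / a"]
        by (simp add: F_def add_divide_distrib floor_add frac_add algebra_simps)
    qed
  qed
  have F_unit: "F (t * a) = f (t * a)" if "0 \<le> t" "t \<le> 1" for t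
  proof (cases "t = 1")
    case True
    then show ?thesis using a f0 by (simp add: F_def g_def)
  next
    case False
    then have "\<lfloor>t\<rfloor> = 0" "frac t = t"
      using that by (auto simp: floor_eq_iff frac_eq)
    then show ?thesis using a by (simp add: F_def g_def)
  qed
  have F_small: "F y = f y" if y: "y \<in> I" "\<bar>y\<bar> \<le> \<bar>a\<bar>" for y
  proof (cases "0 \<le> y / a")
    case True
    moreover have "y / a \<le> 1"
      using y a by (simp add: divide_le_eq_1 abs_if split: if_splits)
    ultimately show ?thesis using F_unit[of "y / a"] a by simp
  next
    case False
    moreover have "- (y / a) \<le> 1"
      using y a abs_divide[of y a] by (smt (verit) divide_le_eq_1_pos zero_less_abs_iff)
    ultimately have t: "0 \<le> - (y / a)" "- (y / a) \<le> 1" by auto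
    then have my: "- y \<in> I" "F (- y) = f (- y)"
      using interval_scale_mem[OF I a(1) t] F_unit[OF t] a by auto
    then have "f y + f (- y) = 0"
      using add[of y "- y"] y I f0 by simp
    then show ?thesis
      using my Modules.additive.minus[OF F, of y] by simp
  qed
  fix x assume x: "x \<in> I"
  obtain m :: nat where "\<bar>x\<bar> / \<bar>a\<bar> \<le> real m"
    using real_arch_simple by blast
  then obtain n :: nat where n: "\<bar>x\<bar> / \<bar>a\<bar> \<le> real n" "n > 0"
    by (intro that[of "Suc m"]) auto
  have mem: "of_nat k * (x / n) \<in> I" if "k \<le> n" for k
    using interval_scale_mem[OF I x, of "k / n"] that n by (simp add: field_simps)
  have fk: "f (of_nat k * (x / n)) = of_nat k * f (x / n)" if "k \<le> n" for k
    using that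
  proof (induction k)
    case 0
    then show ?case using f0 by simp
  next
    case (Suc k)
    then have "f (of_nat k * (x / n) + x / n) = f (of_nat k * (x / n)) + f (x / n)"
      using mem[of k] mem[of 1] mem[of "Suc k"] n by (intro add) (auto simp: algebra_simps add_divide_distrib)
    moreover have "of_nat (Suc k) * (x / n) = of_nat k * (x / n) + x / n"
      by (simp add: algebra_simps add_divide_distrib)
    ultimately show ?case using Suc by (simp add: distrib_right)
  qed
  have "\<bar>x / n\<bar> \<le> \<bar>a\<bar>"
    using n a by (simp add: field_simps)
  then have "F (x / n) = f (x / n)"
    using F_small mem[of 1] n by auto
  then have "F (of_nat n * (x / n)) = f (of_nat n * (x / n))"
    using fk[of n] additive_of_nat_mult[OF F, of n "x / n"] by simp
  then show "F x = f x" using n by simp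
qed

section \<open>Additive functions are linear or have a dense graph\<close>

lemma additive_Rats_mult:
  fixes F :: "real \<Rightarrow> real"
  assumes F: "Modules.additive F" and q: "q \<in> \<rat>"
  shows "F (q * x) = q * F x"
proof -
  have pos: "F (r * y) = r * F y" if r: "r \<in> \<rat>" "0 \<le> r" for r y
  proof -
    obtain m n :: nat where mn: "n \<noteq> 0" "\<bar>r\<bar> = m / n"
      using Rats_abs_nat_div_natE[OF r(1)] by metis
    then have "n * r = m" using r by (simp add: field_simps)
    then have "n * F (r * y) = m * F y"
      using additive_of_nat_mult[OF F, of n "r * y"] additive_of_nat_mult[OF F, of m y]
      by (metis mult.assoc)
    then have "n * F (r * y) = n * (r * F y)"
      using \<open>n * r = m\<close> by (metis mult.assoc)
    then show ?thesis using mn by simp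
  qed
  show ?thesis
  proof (cases "0 \<le> q")
    case True
    then show ?thesis using pos q by simp
  next
    case False
    then show ?thesis
      using pos[of "- q" x] q Modules.additive.minus[OF F, of "q * x"] by simp
  qed
qed

text \<open>
  For all \<open>x\<close> and \<open>y\<close> the determinant of \<open>(x, F x)\<close> and \<open>(y, F y)\<close> must vanish unless the graph is
  dense, since a basis of the plane inside the graph makes its rational combinations dense there.
  A vanishing determinant with \<open>(1, F 1)\<close> says \<open>F y = F 1 \<cdot> y\<close>.
\<close>

lemma additive_linear_or_dense:
  fixes F :: "real \<Rightarrow> real"
  assumes F: "Modules.additive F"
  shows "(\<exists>c. \<forall>x. F x = c * x) \<or> closure (range (\<lambda>x. (x, F x))) = UNIV"
proof (rule disjCI)
  assume "closure (range (\<lambda>x. (x, F x))) \<noteq> UNIV"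
  then obtain u v where uv: "(u, v) \<notin> closure (range (\<lambda>x. (x, F x)))"
    by auto
  have det0: "x * F y - y * F x = 0" for x y
  proof (rule ccontr)
    define D where "D = x * F y - y * F x"
    assume "x * F y - y * F x \<noteq> 0"
    then have D: "D \<noteq> 0" by (simp add: D_def)
    \<comment> \<open>Cramer's rule for the coordinates of \<open>(u, v)\<close> in the basis \<open>(x, F x)\<close>, \<open>(y, F y)\<close>\<close>
    define \<alpha> where "\<alpha> = (u * F y - y * v) / D"
    define \<beta> where "\<beta> = (x * v - u * F x) / D"
    have "D * (\<alpha> * x + \<beta> * y) = D * u" "D * (\<alpha> * F x + \<beta> * F y) = D * v"
      using D by (simp_all add: \<alpha>_def \<beta>_def distrib_left) (simp_all add: D_def algebra_simps)
    then have eq: "\<alpha> * x + \<beta> * y = u" "\<alpha> * F x + \<beta> * F y = v"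
      using D by auto
    have "\<alpha> \<in> closure \<rat>" "\<beta> \<in> closure \<rat>"
      by (simp_all add: Rats_closure_real)
    then obtain p q where p: "\<And>n. p n \<in> \<rat>" "p \<longlonglongrightarrow> \<alpha>" and q: "\<And>n. q n \<in> \<rat>" "q \<longlonglongrightarrow> \<beta>"
      unfolding closure_sequential by metis
    define z where "z n = p n * x + q n * y" for n
    have "F (z n) = p n * F x + q n * F y" for n
      using p q by (simp add: z_def Modules.additive.add[OF F] additive_Rats_mult[OF F])
    moreover have "z \<longlonglongrightarrow> u"
      unfolding z_def eq(1)[symmetric] by (intro tendsto_intros p q)
    moreover have "(\<lambda>n. p n * F x + q n * F y) \<longlonglongrightarrow> v"
      unfolding eq(2)[symmetric] by (intro tendsto_intros p q)
    ultimately have "(\<lambda>n. (z n, F (z n))) \<longlonglongrightarrow> (u, v)"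
      by (auto intro: tendsto_Pair)
    then have "(u, v) \<in> closure (range (\<lambda>x. (x, F x)))"
      unfolding closure_sequential by (intro exI[of _ "\<lambda>n. (z n, F (z n))"]) auto
    with uv show False by simp
  qed
  show "\<exists>c. \<forall>x. F x = c * x"
  proof (intro exI allI)
    fix x
    show "F x = F 1 * x"
      using det0[of 1 x] by (simp add: mult.commute)
  qed
qed

text \<open>
  A dense subset of the plane meets an open set in a dense subset of it, so the open strip over
  the interior of \<open>I\<close> has to be used first; the endpoints of \<open>I\<close> are reached by taking the closure.
\<close>

lemma dense_graph_on_interval:
  fixes I :: "real set"
  assumes I: "is_interval I" "interior I \<noteq> {}"
    and dense: "closure (range (\<lambda>x. (x, F x))) = UNIV" and eq: "\<And>x. x \<in> I \<Longrightarrow> F x = f x"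
  shows "everywhere_dense_in (graph_on I f) (I \<times> UNIV)"
  unfolding everywhere_dense_in_def
proof
  show "graph_on I f \<subseteq> I \<times> UNIV"
    by (auto simp: graph_on_def)
  let ?U = "interior I \<times> (UNIV :: real set)"
  have "I \<subseteq> closure (interior I)"
    using I convex_closure_interior[of I] is_interval_convex closure_subset by blast
  then have "I \<times> UNIV \<subseteq> closure ?U"
    by (auto simp: closure_Times)
  also have "?U \<subseteq> closure (?U \<inter> range (\<lambda>x. (x, F x)))"
    using open_Int_closure_subset[of ?U "range (\<lambda>x. (x, F x))"] dense by (simp add: open_Times)
  then have "closure ?U \<subseteq> closure (?U \<inter> range (\<lambda>x. (x, F x)))"
    by (simp add: closure_minimal)
  also have "?U \<inter> range (\<lambda>x. (x, F x)) \<subseteq> graph_on I f"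
    using eq interior_subset by (fastforce simp: graph_on_def)
  then have "closure (?U \<inter> range (\<lambda>x. (x, F x))) \<subseteq> closure (graph_on I f)"
    by (rule closure_mono)
  finally show "I \<times> UNIV \<subseteq> closure (graph_on I f)" .
qed

lemma linear_graph_not_dense:
  assumes "a \<in> I" "\<And>x. x \<in> I \<Longrightarrow> f x = c * x"
  shows "\<not> everywhere_dense_in (graph_on I f) (I \<times> UNIV)"
proof
  assume "everywhere_dense_in (graph_on I f) (I \<times> UNIV)"
  then have "(a, c * a + 1) \<in> closure (graph_on I f)"
    using assms(1) by (auto simp: everywhere_dense_in_def)
  moreover have "closed {z :: real \<times> real. snd z = c * fst z}"
    by (intro closed_Collect_eq continuous_intros)
  then have "closure (graph_on I f) \<subseteq> {z. snd z = c * fst z}"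
    using assms(2) by (intro closure_minimal) (auto simp: graph_on_def)
  ultimately show False by auto
qed

section \<open>The theorem of Steinhaus for the sumset\<close>

text \<open>
  Cover a bounded part of \<open>A\<close> so efficiently by nonoverlapping intervals that their total length
  exceeds its measure by a factor less than \<open>1 / \<theta>\<close>. If \<open>A\<close> filled at most the fraction \<open>\<theta>\<close> of each
  of them, summation would give too small a measure for \<open>A\<close>.
\<close>

lemma interval_with_large_proportion:
  fixes A :: "real set"
  assumes A: "A \<in> sets lebesgue" "emeasure lebesgue A > 0" and \<theta>: "0 < \<theta>" "\<theta> < 1"
  obtains a b where "a < b" "measure lebesgue (A \<inter> {a..b}) > \<theta> * (b - a)"
proof -
  let ?\<mu> = "measure lebesgue"
  have "\<not> negligible A"
    using A by (auto simp: negligible_iff_null_sets null_sets_def)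
  then obtain l u where "\<not> negligible (A \<inter> cbox l u)"
    using negligible_on_intervals by blast
  define S where "S = A \<inter> cbox l u"
  have S: "S \<in> lmeasurable" "S \<subseteq> cbox l u"
    using A(1) by (auto simp: S_def intro!: bounded_set_imp_lmeasurable)
  then have Spos: "?\<mu> S > 0"
    using \<open>\<not> negligible (A \<inter> cbox l u)\<close> by (simp add: zero_less_measure_iff S_def negligible_iff_measure)
  \<comment> \<open>half of the excess that would give \<open>\<theta> (\<mu> S + e) = \<mu> S\<close>\<close>
  define e where "e = ?\<mu> S * (1 / \<theta> - 1) / 2"
  have e: "e > 0" "\<theta> * (?\<mu> S + e) < ?\<mu> S"
    using Spos \<theta> by (auto simp: e_def field_simps)
  obtain \<D> where \<D>: "countable \<D>"
      "\<And>K. K \<in> \<D> \<Longrightarrow> K \<subseteq> cbox l u \<and> K \<noteq> {} \<and> (\<exists>c d. K = cbox c d)"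
      "pairwise (\<lambda>A B. interior A \<inter> interior B = {}) \<D>"
      "S \<subseteq> \<Union>\<D>" "\<Union>\<D> \<in> lmeasurable" "?\<mu> (\<Union>\<D>) \<le> ?\<mu> S + e"
    using measurable_outer_intervals_bounded[OF S e(1)] by metis
  have \<D>m: "K \<in> lmeasurable" if "K \<in> \<D>" for K
    using \<D>(2)[OF that] by auto
  have "\<exists>K\<in>\<D>. ?\<mu> (S \<inter> K) > \<theta> * ?\<mu> K"
  proof (rule ccontr)
    assume "\<not> ?thesis"
    then have small: "?\<mu> (S \<inter> K) \<le> \<theta> * ?\<mu> K" if "K \<in> \<D>" for K
      using that by (simp add: not_less)
    have "?\<mu> (\<Union>K\<in>\<D>. S \<inter> K) \<le> \<theta> * ?\<mu> (\<Union>\<D>)"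
    proof (rule measure_UN_bound[OF \<D>(1)])
      show "S \<inter> K \<in> lmeasurable" if "K \<in> \<D>" for K
        using S \<D>m[OF that] by (simp add: fmeasurable.Int)
    next
      fix \<F> assume \<F>: "\<F> \<subseteq> \<D>" "finite \<F>"
      have "?\<mu> (\<Union>K\<in>\<F>. S \<inter> K) \<le> (\<Sum>K\<in>\<F>. ?\<mu> (S \<inter> K))"
        using \<F> S \<D>m by (intro measure_UNION_le) auto
      also have "\<dots> \<le> (\<Sum>K\<in>\<F>. \<theta> * ?\<mu> K)"
        using \<F> small by (intro sum_mono) auto
      also have "\<dots> = \<theta> * ?\<mu> (\<Union>\<F>)"
      proof -
        have "pairwise (\<lambda>S T. negligible (S \<inter> T)) \<F>"
        proof (rule pairwiseI)
          fix K L assume KL: "K \<in> \<F>" "L \<in> \<F>" "K \<noteq> L"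
          then have "convex (K \<inter> L)"
            using \<F> \<D>(2) by (metis convex_Int convex_box(1) subsetD)
          moreover have "interior (K \<inter> L) = {}"
            using KL \<F> \<D>(3) by (auto simp: pairwise_def subset_iff)
          ultimately show "negligible (K \<inter> L)"
            by (simp add: negligible_convex_interior)
        qed
        then have "?\<mu> (\<Union>\<F>) = (\<Sum>K\<in>\<F>. ?\<mu> K)"
          using \<F> \<D>m by (intro measure_negligible_finite_Union) auto
        then show ?thesis by (simp add: sum_distrib_left)
      qed
      also have "\<dots> \<le> \<theta> * ?\<mu> (\<Union>\<D>)"
        using \<F> \<D>m \<D>(5) \<theta>
        by (intro mult_left_mono measure_mono_fmeasurable) auto
      finally show "?\<mu> (\<Union>K\<in>\<F>. S \<inter> K) \<le> \<theta> * ?\<mu> (\<Union>\<D>)" .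
    qed
    moreover have "(\<Union>K\<in>\<D>. S \<inter> K) = S"
      using \<D>(4) by auto
    ultimately have "?\<mu> S \<le> \<theta> * (?\<mu> S + e)"
      using \<D>(6) \<theta> by (smt (verit) mult_left_mono)
    with e show False by simp
  qed
  then obtain K where "K \<in> \<D>" "?\<mu> (S \<inter> K) > \<theta> * ?\<mu> K"
    by blast
  moreover from this obtain a b where "K = {a..b}"
    using \<D>(2) by (metis cbox_interval)
  ultimately have K: "{a..b} \<in> \<D>" "?\<mu> (S \<inter> {a..b}) > \<theta> * ?\<mu> {a..b}"
    by simp_all
  have "S \<inter> {a..b} = A \<inter> {a..b}"
    using \<D>(2)[OF K(1)] by (auto simp: S_def simp del: atLeastatMost_subset_iff)
  then have m: "?\<mu> (A \<inter> {a..b}) > \<theta> * ?\<mu> {a..b}"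
    using K by simp
  have "a < b"
  proof (rule ccontr)
    assume "\<not> a < b"
    then have "negligible {a..b}"
      by (cases "a = b") auto
    then have "?\<mu> (A \<inter> {a..b}) = 0"
      by (meson Int_lower2 negligible_subset negligible_imp_measure0)
    with m show False
      using \<theta> measure_nonneg[of lebesgue "{a..b}"] mult_nonneg_nonneg[of \<theta> "?\<mu> {a..b}"] by linarith
  qed
  then show thesis
    using m that by simp
qed

text \<open>
  If \<open>A\<close> fills more than \<open>3 / 4\<close> of \<open>{a..b}\<close>, and \<open>c\<close> is close to \<open>a + b\<close>, then \<open>A \<inter> {a..b}\<close> and its
  reflection \<open>c - (A \<inter> {a..b})\<close> lie in an interval only slightly longer than \<open>{a..b}\<close>. There is no
  room for both of them unless they meet, and a common point is a representation of \<open>c\<close> as a sum.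
\<close>

lemma Steinhaus_sumset:
  fixes A :: "real set"
  assumes "A \<in> sets lebesgue" "emeasure lebesgue A > 0"
  obtains s r where "r > 0" "\<And>c. \<bar>c - s\<bar> < r \<Longrightarrow> \<exists>x\<in>A. \<exists>y\<in>A. c = x + y"
proof -
  let ?\<mu> = "measure lebesgue"
  obtain a b where ab: "a < b" "?\<mu> (A \<inter> {a..b}) > 3 / 4 * (b - a)"
    by (rule interval_with_large_proportion[OF assms, of "3 / 4"]) auto
  define S where "S = A \<inter> {a..b}"
  \<comment> \<open>The two sets have total measure more than \<open>6 r\<close>, and \<open>{a - r..b + r}\<close> has length \<open>6 r\<close>.\<close>
  define r where "r = (b - a) / 4"
  have S: "S \<in> lmeasurable" "S \<subseteq> {a..b}" "?\<mu> S > 3 * r"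
  proof -
    show "S \<in> lmeasurable"
      using assms(1) by (auto simp: S_def intro!: bounded_set_imp_lmeasurable)
    show "S \<subseteq> {a..b}" "?\<mu> S > 3 * r"
      using ab(2) by (simp_all add: S_def r_def)
  qed
  have "\<exists>x\<in>A. \<exists>y\<in>A. c = x + y" if c: "\<bar>c - (a + b)\<bar> < r" for c
  proof (rule ccontr)
    assume no: "\<not> ?thesis"
    define T where "T = (\<lambda>x. -1 * x + c) ` S"
    have T_sub: "T \<subseteq> {c - b..c - a}"
      using S(2) by (auto simp: T_def)
    have "T \<in> sets lebesgue"
      unfolding T_def using S(1)
      by (intro differentiable_image_in_sets_lebesgue derivative_intros) auto
    then have T: "T \<in> lmeasurable" "?\<mu> T = ?\<mu> S"
      using bounded_subset[OF bounded_closed_interval T_sub] measure_lebesgue_affine[of "-1" c S]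
      by (auto simp: T_def intro: bounded_set_imp_lmeasurable)
    have "S \<inter> T = {}"
      using no by (fastforce simp: T_def S_def)
    then have "?\<mu> (S \<union> T) = ?\<mu> S + ?\<mu> T"
      using S T by (simp add: measure_Un3)
    moreover have "S \<union> T \<subseteq> {a - r..b + r}"
    proof -
      have "0 < r"
        using ab by (simp add: r_def)
      moreover have "a - r < c - b" "c - a < b + r"
        using c unfolding abs_less_iff by linarith+
      ultimately have "{a..b} \<subseteq> {a - r..b + r}" "{c - b..c - a} \<subseteq> {a - r..b + r}"
        by simp_all
      then show ?thesis using S(2) T_sub by (meson Un_least order_trans)
    qed
    then have "?\<mu> (S \<union> T) \<le> ?\<mu> {a - r..b + r}"
      using S T by (intro measure_mono_fmeasurable) auto
    moreover have "?\<mu> {a - r..b + r} = 6 * r"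
      using ab by (simp add: r_def field_simps)
    ultimately show False using S T by simp
  qed
  then show thesis
    using that[of r "a + b"] ab by (auto simp: r_def)
qed

section \<open>Regularity hypotheses that force linearity\<close>

lemma additive_bounded_above_imp_linear:
  fixes F :: "real \<Rightarrow> real"
  assumes F: "Modules.additive F" and A: "A \<in> sets lebesgue" "emeasure lebesgue A > 0"
    and bdd: "bdd_above (F ` A)"
  shows "\<exists>c. \<forall>x. F x = c * x"
proof (rule ccontr)
  assume "\<not> ?thesis"
  then have dense: "closure (range (\<lambda>x. (x, F x))) = UNIV"
    using additive_linear_or_dense[OF F] by blast
  obtain M where M: "\<And>x. x \<in> A \<Longrightarrow> F x \<le> M"
    using bdd by (auto simp: bdd_above_def)
  obtain s r where r: "r > 0" "\<And>c. \<bar>c - s\<bar> < r \<Longrightarrow> \<exists>x\<in>A. \<exists>y\<in>A. c = x + y"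
    using Steinhaus_sumset[OF A] by metis
  have bound: "F c \<le> 2 * M" if "\<bar>c - s\<bar> < r" for c
    using r(2)[OF that] M Modules.additive.add[OF F] by (smt (verit))
  let ?U = "{s - r<..<s + r} \<times> {2 * M<..}"
  have "open ?U" "(s, 2 * M + 1) \<in> ?U"
    using r by (auto intro: open_Times)
  then have "?U \<inter> range (\<lambda>x. (x, F x)) \<noteq> {}"
    using dense open_Int_closure_eq_empty[of ?U "range (\<lambda>x. (x, F x))"] by auto
  then obtain x where "x \<in> {s - r<..<s + r}" "F x > 2 * M"
    by blast
  then show False
    using bound[of x] by (simp add: abs_less_iff algebra_simps)
qed

lemma additive_bounded_from_one_side_imp_linear:
  fixes F :: "real \<Rightarrow> real"
  assumes F: "Modules.additive F" and A: "A \<in> sets lebesgue" "emeasure lebesgue A > 0"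
    and bdd: "bounded_from_one_side_on A F"
  shows "\<exists>c. \<forall>x. F x = c * x"
  using bdd unfolding bounded_from_one_side_on_def
proof
  assume "bdd_above (F ` A)"
  then show ?thesis by (rule additive_bounded_above_imp_linear[OF F A])
next
  assume "bdd_below (F ` A)"
  then have "bdd_above (uminus ` F ` A)"
    by simp
  then have "bdd_above ((\<lambda>x. - F x) ` A)"
    unfolding image_image .
  moreover have "Modules.additive (\<lambda>x. - F x)"
    by standard (simp add: Modules.additive.add[OF F])
  ultimately obtain c where "\<forall>x. - F x = c * x"
    using additive_bounded_above_imp_linear[OF _ A] by blast
  then have "\<forall>x. F x = - c * x"
    by (metis minus_minus mult_minus_left)
  then show ?thesis by blast
qed

lemma interval_Icc_subset:
  fixes I :: "real set"
  assumes "is_interval I" "p \<in> I" "q \<in> I"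
  shows "{p..q} \<subseteq> I"
proof
  fix x assume "x \<in> {p..q}"
  then show "x \<in> I"
    by (intro mem_is_interval_1_I[OF assms]) auto
qed

lemma emeasure_Icc_pos:
  fixes p q :: real
  assumes "p < q"
  shows "emeasure lebesgue {p..q} > 0"
  using assms by simp

lemma nontrivial_interval_obtains_Icc:
  assumes "nontrivial_interval I"
  obtains p q where "p < q" "{p..q} \<subseteq> I"
proof -
  have I: "is_interval I" "emeasure lebesgue I > 0"
    using assms by (auto simp: nontrivial_interval_def)
  have "\<not> negligible I"
    using I by (auto simp: negligible_iff_null_sets null_sets_def)
  then have "I \<noteq> {}" "\<And>x. I \<noteq> {x}" by auto
  then obtain p q where "p \<in> I" "q \<in> I" "p \<noteq> q" by blast
  then obtain p q where pq: "p \<in> I" "q \<in> I" "p < q"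
    by (metis linorder_neqE)
  then have "{p..q} \<subseteq> I"
    by (intro interval_Icc_subset I(1))
  with pq show thesis using that by blast
qed

lemma mono_or_antimono_bounded_on_positive_measure:
  fixes I :: "real set" and f :: "real \<Rightarrow> real"
  assumes I: "nontrivial_interval I" and f: "mono_on I f \<or> antimono_on I f"
  shows "\<exists>A\<subseteq>I. A \<in> sets lebesgue \<and> emeasure lebesgue A > 0 \<and> bounded_from_one_side_on A f"
proof -
  obtain p q where pq: "p < q" "{p..q} \<subseteq> I"
    using nontrivial_interval_obtains_Icc[OF I] by blast
  then have p: "p \<in> I" by auto
  have "bounded_from_one_side_on {p..q} f"
    using f
  proof
    assume "mono_on I f"
    then have "\<forall>x\<in>{p..q}. f p \<le> f x"
      using pq p by (auto simp: monotone_on_def)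
    then show ?thesis
      unfolding bounded_from_one_side_on_def by (intro disjI2 bdd_belowI2) auto
  next
    assume "antimono_on I f"
    then have "\<forall>x\<in>{p..q}. f x \<le> f p"
      using pq p by (auto simp: monotone_on_def)
    then show ?thesis
      unfolding bounded_from_one_side_on_def by (intro disjI1 bdd_aboveI2) auto
  qed
  then show ?thesis
    using pq emeasure_Icc_pos by (intro exI[of _ "{p..q}"]) auto
qed

lemma continuous_at_point_bounded_on_positive_measure:
  fixes I :: "real set" and f :: "real \<Rightarrow> real"
  assumes I: "nontrivial_interval I" and x: "x \<in> I" "continuous (at x within I) f"
  shows "\<exists>A\<subseteq>I. A \<in> sets lebesgue \<and> emeasure lebesgue A > 0 \<and> bounded_from_one_side_on A f"
proof -
  obtain d where d: "d > 0" "\<And>y. y \<in> I \<Longrightarrow> dist y x < d \<Longrightarrow> dist (f y) (f x) < 1"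
    using x(2) unfolding continuous_within_eps_delta by (metis zero_less_one)
  have int: "is_interval I"
    using I by (simp add: nontrivial_interval_def)
  \<comment> \<open>As \<open>x\<close> can be an endpoint of \<open>I\<close>, the bound is taken on an interval on one side of \<open>x\<close>,
    the side on which \<open>I\<close> has another point \<open>y\<close>.\<close>
  have "\<exists>y\<in>I. y \<noteq> x"
  proof -
    obtain p q where "p < q" "{p..q} \<subseteq> I"
      using nontrivial_interval_obtains_Icc[OF I] by blast
    then have "p \<in> I" "q \<in> I" "p \<noteq> q" by auto
    then show ?thesis by metis
  qed
  then obtain y where y: "y \<in> I" "y \<noteq> x" by blast
  obtain p q where pq: "p < q" "{p..q} \<subseteq> I" "{p..q} \<subseteq> ball x d"
  proof (cases "x < y")
    case True
    define q where "q = min y (x + d / 2)"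
    have "x < q" "q \<le> y" "q < x + d"
      using True d by (auto simp: q_def min_def)
    moreover from this have "{x..q} \<subseteq> {x..y}" "{x..q} \<subseteq> ball x d"
      by (auto simp: ball_def dist_real_def)
    moreover have "{x..y} \<subseteq> I"
      by (intro interval_Icc_subset int x(1) y(1))
    ultimately show thesis
      using that[of x q] by blast
  next
    case False
    define q where "q = max y (x - d / 2)"
    have "q < x" "y \<le> q" "x - d < q"
      using False y d by (auto simp: q_def max_def)
    moreover from this have "{q..x} \<subseteq> {y..x}" "{q..x} \<subseteq> ball x d"
      by (auto simp: ball_def dist_real_def)
    moreover have "{y..x} \<subseteq> I"
      by (intro interval_Icc_subset int x(1) y(1))
    ultimately show thesis
      using that[of q x] by blast
  qed
  have "f z \<le> f x + 1" if "z \<in> {p..q}" for z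
  proof -
    have "z \<in> I" "dist z x < d"
      using pq(2,3) that by (auto simp: dist_commute)
    then show ?thesis
      using d(2)[of z] unfolding dist_real_def by linarith
  qed
  then have "bounded_from_one_side_on {p..q} f"
    unfolding bounded_from_one_side_on_def by (intro disjI1 bdd_aboveI2) auto
  then show ?thesis
    using pq emeasure_Icc_pos by (intro exI[of _ "{p..q}"]) auto
qed

lemma measurable_bounded_on_positive_measure:
  fixes I :: "real set" and f :: "real \<Rightarrow> real"
  assumes I: "nontrivial_interval I" and f: "f \<in> borel_measurable (lebesgue_on I)"
  shows "\<exists>A\<subseteq>I. A \<in> sets lebesgue \<and> emeasure lebesgue A > 0 \<and> bounded_from_one_side_on A f"
proof -
  have Im: "I \<in> sets lebesgue"
    using I by (auto simp: nontrivial_interval_def emeasure_notin_sets intro: ccontr)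
  define B where "B n = {x \<in> I. f x \<le> real n}" for n
  have B: "B n \<in> sets lebesgue" for n
  proof -
    have "{x \<in> space (lebesgue_on I). f x \<le> real n} \<in> sets (lebesgue_on I)"
      using f by measurable
    then show ?thesis
      using Im by (simp add: B_def sets_restrict_space_iff space_restrict_space)
  qed
  have "I = (\<Union>n. B n)"
    by (auto simp: B_def real_arch_simple)
  have "\<exists>n. emeasure lebesgue (B n) \<noteq> 0"
  proof (rule ccontr)
    assume "\<not> ?thesis"
    then have "(\<Union>n. B n) \<in> null_sets lebesgue"
      using B by (intro null_sets_UN) (auto simp: null_sets_def)
    then show False
      using I \<open>I = (\<Union>n. B n)\<close> by (simp add: nontrivial_interval_def null_sets_def)
  qed
  then obtain n where "emeasure lebesgue (B n) > 0"
    by (auto simp: zero_less_iff_neq_zero)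
  moreover have "bounded_from_one_side_on (B n) f"
    unfolding bounded_from_one_side_on_def by (intro disjI1 bdd_aboveI2[of _ _ "real n"]) (auto simp: B_def)
  ultimately show ?thesis
    using B by (intro exI[of _ "B n"]) (auto simp: B_def)
qed

section \<open>The dichotomy and the regular case\<close>

theorem theorem1:
  fixes I :: "real set" and f :: "real \<Rightarrow> real"
  assumes "nontrivial_interval I" and "0 \<in> I"
    and "\<And>x x'. x \<in> I \<Longrightarrow> x' \<in> I \<Longrightarrow> x + x' \<in> I \<Longrightarrow> f (x + x') = f x + f x'"
  shows "((\<exists>c. \<forall>x\<in>I. f x = c * x) \<or> everywhere_dense_in (graph_on I f) (I \<times> UNIV)) \<and>
    ((\<exists>x\<in>I. continuous (at x within I) f)
      \<or> (mono_on I f \<or> antimono_on I f)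
      \<or> f \<in> borel_measurable (lebesgue_on I)
      \<or> (\<exists>A\<subseteq>I. A \<in> sets lebesgue \<and> emeasure lebesgue A > 0 \<and> bounded_from_one_side_on A f)
     \<longrightarrow> \<not> everywhere_dense_in (graph_on I f) (I \<times> UNIV))"
proof -
  have int: "is_interval I"
    using assms(1) by (simp add: nontrivial_interval_def)
  obtain p q where pq: "p < q" "{p..q} \<subseteq> I"
    using nontrivial_interval_obtains_Icc[OF assms(1)] by blast
  then have "p \<in> I" "q \<in> I" "p \<noteq> q" by auto
  then obtain a where a: "a \<in> I" "a \<noteq> 0" by metis
  obtain F where F: "Modules.additive F" "\<And>x. x \<in> I \<Longrightarrow> F x = f x"
    by (rule additive_extension[OF int assms(2) a, of f]) (use assms(3) in blast)+
  have "{p<..<q} \<subseteq> interior I"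
    using pq by (intro interior_maximal) auto
  moreover have "(p + q) / 2 \<in> {p<..<q}"
    using pq(1) by simp
  ultimately have "interior I \<noteq> {}"
    by blast
  then have "everywhere_dense_in (graph_on I f) (I \<times> UNIV)"
    if "closure (range (\<lambda>x. (x, F x))) = UNIV"
    using dense_graph_on_interval[OF int _ that] F(2) by blast
  then have "(\<exists>c. \<forall>x\<in>I. f x = c * x) \<or> everywhere_dense_in (graph_on I f) (I \<times> UNIV)"
    using additive_linear_or_dense[OF F(1)] F(2) by metis
  moreover have "\<not> everywhere_dense_in (graph_on I f) (I \<times> UNIV)"
    if regular: "(\<exists>x\<in>I. continuous (at x within I) f)
      \<or> (mono_on I f \<or> antimono_on I f)
      \<or> f \<in> borel_measurable (lebesgue_on I)
      \<or> (\<exists>A\<subseteq>I. A \<in> sets lebesgue \<and> emeasure lebesgue A > 0 \<and> bounded_from_one_side_on A f)"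
  proof -
    have "\<exists>A\<subseteq>I. A \<in> sets lebesgue \<and> emeasure lebesgue A > 0 \<and> bounded_from_one_side_on A f"
      using regular continuous_at_point_bounded_on_positive_measure[OF assms(1)]
        mono_or_antimono_bounded_on_positive_measure[OF assms(1)]
        measurable_bounded_on_positive_measure[OF assms(1)] by blast
    then obtain A where A: "A \<subseteq> I" "A \<in> sets lebesgue" "emeasure lebesgue A > 0"
        "bounded_from_one_side_on A f" by blast
    have "F ` A = f ` A"
      using A(1) F(2) by (intro image_cong) auto
    then have "bounded_from_one_side_on A F"
      using A(4) by (simp add: bounded_from_one_side_on_def)
    then obtain c where "\<forall>x. F x = c * x"
      using additive_bounded_from_one_side_imp_linear[OF F(1) A(2,3)] by blast
    then show ?thesis
      using linear_graph_not_dense[OF assms(2)] F(2) by metis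
  qed
  ultimately show ?thesis by blast
qed

end
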